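(* Let $0<\gamma<\delta$ and $h\in H(\mathbb{D})$. The multiplication operator $M_h\colon A^{-\gamma}\to A^{-\delta}_0$ exists (i.e. $hf\in A^{-\delta}_0$ for all $f\in A^{-\gamma}$) if and only if $h\in A^{-(\delta-\gamma)}_0$. That is, $$\mathcal{M}(A^{-\gamma},A^{-\delta}_0)=A^{-(\delta-\gamma)}_0.$$
   Context: $\mathbb{D}$ is the open unit disc in $\mathbb{C}$ and $H(\mathbb{D})$ is the space of analytic functions on $\mathbb{D}$. For $\gamma>0$, $A^{-\gamma}:=\{f\in H(\mathbb{D}): \|f\|_{-\gamma}:=\sup_{z\in\mathbb{D}}(1-|z|)^\gamma|f(z)|<\infty\}$ and $A^{-\gamma}_0:=\{f\in H(\mathbb{D}): \lim_{|z|\to1^-}(1-|z|)^\gamma|f(z)|=0\}$, both with norm $\|\cdot\|_{-\gamma}$. $M_hf:=hf$ denotes pointwise multiplication by $h$, and for Banach spaces $X,Y$ of analytic functions on $\mathbb{D}$, $\mathcal{M}(X,Y):=\{h\in H(\mathbb{D}): M_h(X)\subseteq Y\}$. *)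

theory Defs
  imports "HOL-Complex_Analysis.Complex_Analysis"
begin

text \<open>
  A function on the open unit disc is represented by a total function
  \<open>complex \<Rightarrow> complex\<close>; its values outside the disc are arbitrary, and
  none of the sets below constrains them.
\<close>

abbreviation unit_disc :: "complex set" where
  "unit_disc \<equiv> ball 0 1"

definition analytic_disc :: "(complex \<Rightarrow> complex) set" where
  "analytic_disc = {f. f holomorphic_on unit_disc}"

text \<open>The supremum is taken in the extended reals, so it may be infinite.\<close>

definition growth_norm :: "real \<Rightarrow> (complex \<Rightarrow> complex) \<Rightarrow> ereal" where
  "growth_norm \<gamma> f = (SUP z\<in>unit_disc. ereal ((1 - cmod z) powr \<gamma> * cmod (f z)))"

definition growth_space :: "real \<Rightarrow> (complex \<Rightarrow> complex) set" where
  "growth_space \<gamma> = {f \<in> analytic_disc. growth_norm \<gamma> f < \<infinity>}"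

text \<open>
  The filter \<open>filtercomap cmod (at_left 1)\<close> expresses that the modulus of \<open>z\<close> tends
  to 1 from below, uniformly in the argument of \<open>z\<close>.
\<close>

definition little_growth_space :: "real \<Rightarrow> (complex \<Rightarrow> complex) set" where
  "little_growth_space \<gamma> = {f \<in> analytic_disc.
     ((\<lambda>z. (1 - cmod z) powr \<gamma> * cmod (f z)) \<longlongrightarrow> 0) (filtercomap cmod (at_left 1))}"

definition mult_op :: "(complex \<Rightarrow> complex) \<Rightarrow> (complex \<Rightarrow> complex) \<Rightarrow> complex \<Rightarrow> complex" where
  "mult_op h f = (\<lambda>z. h z * f z)"

definition multipliers ::
  "(complex \<Rightarrow> complex) set \<Rightarrow> (complex \<Rightarrow> complex) set \<Rightarrow> (complex \<Rightarrow> complex) set" where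
  "multipliers X Y = {h \<in> analytic_disc. mult_op h ` X \<subseteq> Y}"

end

theory Submission
  imports Defs
begin

text \<open>
  If \<open>h\<close> is not in the little space, there are points \<open>\<zeta>\<^sub>k\<close> with \<open>r\<^sub>k = 1 - |\<zeta>\<^sub>k|\<close> tending to 0 as
  fast as desired, at which \<open>(1 - |z|)\<^sup>\<delta>\<^sup>-\<^sup>\<gamma> |h z|\<close> stays above some \<open>e > 0\<close>. The lacunary
  series \<open>f z = \<Sum>\<^sub>k r\<^sub>k\<^sup>-\<^sup>\<gamma> z\<^sup>m\<close> with exponents \<open>m = \<lceil>1/r\<^sub>k\<rceil>\<close> lies in the big space, because its
  \<open>k\<close>-th term, weighted at \<open>|z| = 1 - s\<close>, is dominated by a constant times \<open>min u (1/u)\<close> with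
  \<open>u = (s/r\<^sub>k)\<^sup>\<gamma>\<close>. At \<open>\<zeta>\<^sub>k\<close> the \<open>k\<close>-th term outweighs all others together, so \<open>f\<close> has maximal
  growth along the sequence and \<open>h f\<close> does not decay.
\<close>

section \<open>Pointwise descriptions of the two spaces\<close>

lemma growth_space_iff:
  "f \<in> growth_space \<gamma> \<longleftrightarrow>
     f holomorphic_on unit_disc \<and> (\<exists>B. \<forall>z\<in>unit_disc. (1 - cmod z) powr \<gamma> * cmod (f z) \<le> B)"
proof -
  have "growth_norm \<gamma> f < \<infinity> \<longleftrightarrow> (\<exists>B. \<forall>z\<in>unit_disc. (1 - cmod z) powr \<gamma> * cmod (f z) \<le> B)"
  proof
    assume fin: "growth_norm \<gamma> f < \<infinity>"
    obtain B :: real where "growth_norm \<gamma> f \<le> ereal B"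
      using fin by (cases "growth_norm \<gamma> f") auto
    then show "\<exists>B. \<forall>z\<in>unit_disc. (1 - cmod z) powr \<gamma> * cmod (f z) \<le> B"
      unfolding growth_norm_def SUP_le_iff by auto
  next
    assume "\<exists>B. \<forall>z\<in>unit_disc. (1 - cmod z) powr \<gamma> * cmod (f z) \<le> B"
    then obtain B where "\<forall>z\<in>unit_disc. (1 - cmod z) powr \<gamma> * cmod (f z) \<le> B" ..
    then have "growth_norm \<gamma> f \<le> ereal B"
      unfolding growth_norm_def SUP_le_iff by auto
    then show "growth_norm \<gamma> f < \<infinity>"
      by (rule order.strict_trans1) simp
  qed
  then show ?thesis
    by (simp add: growth_space_def analytic_disc_def)
qed

text \<open>The annuli \<open>1 - d < cmod z < 1\<close> form a base of the filter
  \<open>filtercomap cmod (at_left 1)\<close>.\<close>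

lemma little_growth_space_iff:
  "f \<in> little_growth_space \<gamma> \<longleftrightarrow>
     f holomorphic_on unit_disc \<and>
     (\<forall>e>0. \<exists>d>0. \<forall>z. 1 - d < cmod z \<and> cmod z < 1 \<longrightarrow> (1 - cmod z) powr \<gamma> * cmod (f z) < e)"
proof -
  have "((\<lambda>z. (1 - cmod z) powr \<gamma> * cmod (f z)) \<longlongrightarrow> 0) (filtercomap cmod (at_left 1)) \<longleftrightarrow>
    (\<forall>e>0. \<exists>d>0. \<forall>z. 1 - d < cmod z \<and> cmod z < 1 \<longrightarrow> (1 - cmod z) powr \<gamma> * cmod (f z) < e)"
    (is "?L \<longleftrightarrow> ?R")
  proof -
    have *: "eventually P (filtercomap cmod (at_left 1)) \<longleftrightarrow>
        (\<exists>d>0. \<forall>z. 1 - d < cmod z \<and> cmod z < 1 \<longrightarrow> P z)" for P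
    proof
      assume "eventually P (filtercomap cmod (at_left 1))"
      then obtain b where "b < 1" "\<forall>z. b < cmod z \<and> cmod z < 1 \<longrightarrow> P z"
        unfolding eventually_filtercomap eventually_at_left_field by blast
      then show "\<exists>d>0. \<forall>z. 1 - d < cmod z \<and> cmod z < 1 \<longrightarrow> P z"
        by (intro exI[of _ "1 - b"]) auto
    next
      assume "\<exists>d>0. \<forall>z. 1 - d < cmod z \<and> cmod z < 1 \<longrightarrow> P z"
      then obtain d where d: "d > 0" "\<forall>z. 1 - d < cmod z \<and> cmod z < 1 \<longrightarrow> P z" by blast
      have "eventually (\<lambda>y. 1 - d < y \<and> y < 1) (at_left 1)"
        unfolding eventually_at_left_field using d(1) by (intro exI[of _ "1 - d"]) auto
      then show "eventually P (filtercomap cmod (at_left 1))"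
        unfolding eventually_filtercomap using d(2) by blast
    qed
    show ?thesis
      unfolding tendsto_iff * by (simp add: dist_norm abs_mult)
  qed
  then show ?thesis
    by (simp add: little_growth_space_def analytic_disc_def)
qed

section \<open>Sufficiency: little growth times bounded growth\<close>

text \<open>The weight with exponent \<alpha> + \<gamma> splits into one weight for each factor, so
  the weighted product is a null factor times a bounded one.\<close>

lemma mult_op_little_growth:
  assumes h: "h \<in> little_growth_space \<alpha>" and f: "f \<in> growth_space \<gamma>"
  shows "mult_op h f \<in> little_growth_space (\<alpha> + \<gamma>)"
  unfolding little_growth_space_iff
proof (intro conjI allI impI)
  show "mult_op h f holomorphic_on unit_disc"
    using h f unfolding mult_op_def little_growth_space_iff growth_space_iff
    by (intro holomorphic_intros) auto
next
  fix e :: real assume "e > 0"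
  obtain B where B: "\<And>z. cmod z < 1 \<Longrightarrow> (1 - cmod z) powr \<gamma> * cmod (f z) \<le> B"
    using f unfolding growth_space_iff by (metis mem_ball_0)
  \<comment> \<open>The maximum with 1 makes the bound positive, so that \<open>e / B'\<close> is an
    admissible threshold for \<open>h\<close>.\<close>
  define B' where "B' = max 1 B"
  have B': "B' > 0" "\<And>z. cmod z < 1 \<Longrightarrow> (1 - cmod z) powr \<gamma> * cmod (f z) \<le> B'"
    using B by (auto simp: B'_def le_max_iff_disj)
  have "e / B' > 0"
    using \<open>e > 0\<close> B'(1) by simp
  then obtain d where d: "d > 0"
    "\<And>z. 1 - d < cmod z \<Longrightarrow> cmod z < 1 \<Longrightarrow> (1 - cmod z) powr \<alpha> * cmod (h z) < e / B'"
    using h unfolding little_growth_space_iff by meson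
  have "(1 - cmod z) powr (\<alpha> + \<gamma>) * cmod (mult_op h f z) < e"
    if z: "1 - d < cmod z" "cmod z < 1" for z
  proof -
    have "(1 - cmod z) powr (\<alpha> + \<gamma>) * cmod (mult_op h f z) =
        ((1 - cmod z) powr \<alpha> * cmod (h z)) * ((1 - cmod z) powr \<gamma> * cmod (f z))"
      by (simp add: powr_add mult_op_def norm_mult)
    also have "\<dots> \<le> ((1 - cmod z) powr \<alpha> * cmod (h z)) * B'"
      using B'(2)[OF z(2)] by (intro mult_left_mono) auto
    also have "\<dots> < e / B' * B'"
      using d(2)[OF z] B'(1) by (intro mult_strict_right_mono) auto
    finally show ?thesis
      using B'(1) by simp
  qed
  then show "\<exists>d>0. \<forall>z. 1 - d < cmod z \<and> cmod z < 1 \<longrightarrow>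
      (1 - cmod z) powr (\<alpha> + \<gamma>) * cmod (mult_op h f z) < e"
    using d(1) by blast
qed

section \<open>Sums along lacunary sequences\<close>

text \<open>
  Each term is dominated by a constant times the increment of \<open>u / (1 + u)\<close> from
  \<open>u k\<close> to \<open>u (Suc k)\<close>, and these increments telescope.
\<close>

lemma lacunary_sum_min_le:
  fixes u :: "nat \<Rightarrow> real"
  assumes pos: "\<And>k. u k > 0" and lac: "\<And>k. 2 * u k \<le> u (Suc k)"
  shows "(\<Sum>k<n. min (u k) (1 / u k)) \<le> 6"
proof -
  have "min (u k) (1 / u k) \<le> 6 * (u (Suc k) / (1 + u (Suc k)) - u k / (1 + u k))" for k
  proof -
    have "min a (1 / a) \<le> 6 * (b / (1 + b) - a / (1 + a))"
      if "a > 0" "2 * a \<le> b" for a b :: real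
    proof -
      \<comment> \<open>The case \<open>b = 2 * a\<close> suffices, since \<open>x / (1 + x)\<close>
        is increasing. The denominator here is at most 6 for \<open>a \<le> 1\<close> and at most
        \<open>6 * a * a\<close> for \<open>a > 1\<close>, which gives the constant 6.\<close>
      have diff: "2 * a / (1 + 2 * a) - a / (1 + a) = a / ((1 + a) * (1 + 2 * a))"
        using \<open>a > 0\<close> by (simp add: divide_simps) (simp add: algebra_simps)
      have pos': "(1 + a) * (1 + 2 * a) > 0"
        using \<open>a > 0\<close> by simp
      have "min a (1 / a) \<le> 6 * (2 * a / (1 + 2 * a) - a / (1 + a))"
      proof (cases "a \<le> 1")
        case True
        have "a * ((1 + a) * (1 + 2 * a)) \<le> a * 6"
          using True \<open>a > 0\<close> mult_mono[of "1 + a" 2 "1 + 2 * a" 3]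
          by (intro mult_left_mono) auto
        then have "a \<le> 6 * (2 * a / (1 + 2 * a) - a / (1 + a))"
          unfolding diff times_divide_eq_right pos_le_divide_eq[OF pos'] by (simp add: mult_ac)
        then show ?thesis by simp
      next
        case False
        have "(1 + a) * (1 + 2 * a) \<le> (2 * a) * (3 * a)"
          using False by (intro mult_mono) auto
        then have "1 / a \<le> 6 * (2 * a / (1 + 2 * a) - a / (1 + a))"
          unfolding diff times_divide_eq_right pos_le_divide_eq[OF pos']
          using \<open>a > 0\<close> by (simp add: field_simps)
        then show ?thesis by simp
      qed
      also have "2 * a / (1 + 2 * a) \<le> b / (1 + b)"
        using that by (simp add: field_simps)
      finally show ?thesis by simp
    qed
    then show ?thesis
      using pos lac by blast
  qed
  then have "(\<Sum>k<n. min (u k) (1 / u k)) \<le>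
      (\<Sum>k<n. 6 * (u (Suc k) / (1 + u (Suc k)) - u k / (1 + u k)))"
    by (intro sum_mono)
  also have "\<dots> = 6 * (u n / (1 + u n) - u 0 / (1 + u 0))"
    unfolding sum_distrib_left[symmetric]
    using sum_lessThan_telescope[of "\<lambda>k. u k / (1 + u k)" n] by simp
  also have "\<dots> \<le> 6 * 1"
  proof -
    have "u n / (1 + u n) \<le> 1" "u 0 / (1 + u 0) \<ge> 0"
      using pos[of n] pos[of 0] by auto
    from diff_mono[OF this] show ?thesis by simp
  qed
  finally show ?thesis by simp
qed

text \<open>Lacunarity gives \<open>(R - 1) * u j \<le> u (Suc j) - u j\<close>, and the right-hand
  sides telescope.\<close>

lemma lacunary_sum_below_le:
  fixes u :: "nat \<Rightarrow> real"
  assumes pos: "\<And>k. u k > 0" and R: "R > 1" and lac: "\<And>k. R * u k \<le> u (Suc k)"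
  shows "(\<Sum>j<k. u j) \<le> u k / (R - 1)"
proof -
  have "(R - 1) * (\<Sum>j<k. u j) \<le> (\<Sum>j<k. u (Suc j) - u j)"
    unfolding sum_distrib_left using lac by (intro sum_mono) (simp add: algebra_simps)
  also have "\<dots> = u k - u 0"
    by (rule sum_lessThan_telescope)
  finally show ?thesis
    using pos[of 0] R by (simp add: field_simps)
qed

text \<open>The reciprocals satisfy
  \<open>(R - 1) / u j \<le> R * (1 / u j - 1 / u (Suc j))\<close>. Telescoping leaves at most
  \<open>R / u (Suc k) \<le> 1 / u k\<close>. The bound is uniform in \<open>n\<close>, so it
  survives the passage to the infinite series.\<close>

lemma lacunary_sum_above_le:
  fixes u :: "nat \<Rightarrow> real"
  assumes pos: "\<And>k. u k > 0" and R: "R > 1" and lac: "\<And>k. R * u k \<le> u (Suc k)"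
  shows "(\<Sum>j=Suc k..<n. 1 / u j) \<le> 1 / (u k * (R - 1))"
proof (cases "Suc k \<le> n")
  case True
  have "(R - 1) * (1 / u j) \<le> R * (1 / u j - 1 / u (Suc j))" for j
  proof -
    have "R * (1 / u (Suc j)) \<le> 1 / u j"
      using lac[of j] pos[of j] pos[of "Suc j"] by (simp add: field_simps)
    then show ?thesis unfolding left_diff_distrib right_diff_distrib by linarith
  qed
  then have "(R - 1) * (\<Sum>j=Suc k..<n. 1 / u j) \<le> (\<Sum>j=Suc k..<n. R * (1 / u j - 1 / u (Suc j)))"
    unfolding sum_distrib_left by (intro sum_mono)
  also have "\<dots> = R * (1 / u (Suc k) - 1 / u n)"
    unfolding sum_distrib_left[symmetric]
    using sum_Suc_diff'[OF True, of "\<lambda>j. - (1 / u j)"] by simp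
  also have "\<dots> \<le> R * (1 / u (Suc k))"
    using pos[of n] R by (intro mult_left_mono) auto
  also have "\<dots> \<le> 1 / u k"
    using lac[of k] pos[of k] pos[of "Suc k"] by (simp add: field_simps)
  finally show ?thesis
    using R pos[of k] by (simp add: field_simps)
next
  case False
  then show ?thesis using R pos[of k] by simp
qed

section \<open>Estimates for a single term of the series\<close>

text \<open>The power is the constant in \<open>t powr a \<le> a powr a * exp t\<close> for
  \<open>a = 2 * \<gamma>\<close>. The maximum with 1 lets the same constant serve in the trivial
  bound by \<open>u\<close>.\<close>

definition bump_const :: "real \<Rightarrow> real" where
  "bump_const \<gamma> = max 1 ((2 * \<gamma>) powr (2 * \<gamma>))"

text \<open>This is \<open>x \<le> exp x\<close> at \<open>x = t / a\<close>, raised to the power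
  \<open>a\<close>.\<close>

lemma powr_le_const_exp:
  fixes a t :: real
  assumes "a > 0" "t > 0"
  shows "t powr a \<le> a powr a * exp t"
proof -
  have "t / a \<le> exp (t / a)"
    using exp_ge_add_one_self[of "t / a"] by linarith
  then have "(t / a) powr a \<le> exp (t / a) powr a"
    using assms by (intro powr_mono2) auto
  also have "exp (t / a) powr a = exp t"
    using assms by (simp add: powr_def)
  finally show ?thesis
    using assms by (simp add: powr_divide field_simps)
qed

text \<open>With an exponent of order \<open>1 / r\<close>, the monomial is still of constant size
  at modulus \<open>1 - r\<close> and decays exponentially in \<open>s / r\<close> at modulus
  \<open>1 - s\<close>.\<close>

definition bump_exponent :: "real \<Rightarrow> nat" where
  "bump_exponent r = nat \<lceil>1 / r\<rceil>"

text \<open>Put \<open>t = s / r\<close>, so that \<open>u = t powr \<gamma>\<close>. The power of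
  \<open>1 - s\<close> is at most 1, which gives the bound by \<open>u\<close>. It is also at most
  \<open>exp (- t)\<close>, and \<open>u * u = t powr (2 * \<gamma>)\<close> is at most a constant
  times \<open>exp t\<close>, which gives the bound by \<open>1 / u\<close>.\<close>

lemma bump_upper:
  assumes "\<gamma> > 0" "r > 0" "0 < s" "s \<le> 1"
  defines "u \<equiv> s powr \<gamma> * r powr (- \<gamma>)"
  shows "u * (1 - s) ^ bump_exponent r \<le> bump_const \<gamma> * min u (1 / u)"
proof -
  have u: "u > 0" using assms by (simp add: u_def)
  define t where "t = s / r"
  have t: "t > 0" using assms by (simp add: t_def)
  have ut: "u = t powr \<gamma>"
    using assms by (simp add: u_def t_def powr_divide powr_minus_divide)
  have "(1 - s) ^ bump_exponent r \<le> exp (- s) ^ bump_exponent r"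
    using assms exp_ge_add_one_self[of "- s"] by (intro power_mono) auto
  also have "\<dots> = exp (- (real (bump_exponent r) * s))"
    by (simp add: exp_of_nat_mult[symmetric])
  also have "\<dots> \<le> exp (- t)"
  proof -
    have "1 / r \<le> real (bump_exponent r)"
      unfolding bump_exponent_def by linarith
    then have "1 / r * s \<le> real (bump_exponent r) * s"
      using assms by (intro mult_right_mono) auto
    then show ?thesis by (simp add: t_def)
  qed
  finally have pow: "(1 - s) ^ bump_exponent r \<le> exp (- t)" .
  have "u * (1 - s) ^ bump_exponent r \<le> u * 1"
    using u assms by (intro mult_left_mono power_le_one) auto
  also have "\<dots> \<le> bump_const \<gamma> * u"
    using u by (simp add: bump_const_def)
  finally have 1: "u * (1 - s) ^ bump_exponent r \<le> bump_const \<gamma> * u" .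
  have "u * u = t powr (2 * \<gamma>)"
    by (simp add: ut powr_add[symmetric])
  also have "\<dots> \<le> (2 * \<gamma>) powr (2 * \<gamma>) * exp t"
    using powr_le_const_exp[of "2 * \<gamma>" t] assms t by simp
  also have "\<dots> \<le> bump_const \<gamma> * exp t"
    by (intro mult_right_mono) (auto simp: bump_const_def)
  finally have "u * exp (- t) \<le> bump_const \<gamma> * (1 / u)"
    using u by (simp add: exp_minus field_simps)
  moreover have "u * (1 - s) ^ bump_exponent r \<le> u * exp (- t)"
    using u pow by (intro mult_left_mono) auto
  ultimately have 2: "u * (1 - s) ^ bump_exponent r \<le> bump_const \<gamma> * (1 / u)"
    by linarith
  show ?thesis
    using 1 2 by (auto simp: min_def)
qed

text \<open>For \<open>r \<le> 1 / 2\<close> one has \<open>1 - r \<ge> exp (- 2 * r)\<close>.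
  Rounding up adds at most 1 to \<open>1 / r\<close>, so exponent times \<open>r\<close> is at most
  \<open>1 + r \<le> 2\<close>.\<close>

lemma bump_lower:
  assumes "0 < r" "r \<le> 1 / 2"
  shows "exp (- 4) \<le> (1 - r) ^ bump_exponent r"
proof -
  have "- (2 * r) \<le> - r - 2 * r\<^sup>2"
    using assms by (simp add: power2_eq_square)
  also have "\<dots> \<le> ln (1 - r)"
    using assms ln_one_minus_pos_lower_bound[of r] by simp
  finally have "exp (- (2 * r)) \<le> 1 - r"
    using assms by (simp add: ln_ge_iff)
  then have "exp (- (2 * r)) ^ bump_exponent r \<le> (1 - r) ^ bump_exponent r"
    by (intro power_mono) auto
  moreover have "exp (- (2 * r)) ^ bump_exponent r = exp (- (2 * (real (bump_exponent r) * r)))"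
    by (simp add: exp_of_nat_mult[symmetric] mult_ac)
  moreover have "real (bump_exponent r) * r \<le> 2"
  proof -
    have "1 / r \<ge> 1" using assms by simp
    then have "real (bump_exponent r) \<le> 1 / r + 1"
      unfolding bump_exponent_def by linarith
    then have "real (bump_exponent r) * r \<le> (1 / r + 1) * r"
      using assms by (intro mult_right_mono) auto
    also have "\<dots> = 1 + r" using assms by (simp add: distrib_right)
    finally show ?thesis using assms by linarith
  qed
  ultimately show ?thesis
    by (smt (verit) exp_le_cancel_iff)
qed

section \<open>The lacunary series\<close>

text \<open>The Weierstrass M-test gives uniform convergence on small closed discs, and locally
  uniform limits of holomorphic functions are holomorphic.\<close>

lemma holomorphic_suminf_disc:
  fixes g :: "nat \<Rightarrow> complex \<Rightarrow> complex"
  assumes hol: "\<And>k. g k holomorphic_on unit_disc"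
    and M: "\<And>\<rho>. 0 < \<rho> \<Longrightarrow> \<rho> < 1 \<Longrightarrow> \<exists>M. summable M \<and> (\<forall>k z. cmod z \<le> \<rho> \<longrightarrow> cmod (g k z) \<le> M k)"
  shows "(\<lambda>z. \<Sum>k. g k z) holomorphic_on unit_disc"
proof (rule holomorphic_uniform_sequence[where f = "\<lambda>n z. \<Sum>k<n. g k z"])
  show "(\<lambda>z. \<Sum>k<n. g k z) holomorphic_on unit_disc" for n
    by (intro holomorphic_intros hol)
  fix z :: complex assume z: "z \<in> unit_disc"
  \<comment> \<open>Half the distance to the unit circle keeps \<open>cball z d\<close> inside a
    closed disc about 0 of radius less than 1, where a majorant exists.\<close>
  define d where "d = (1 - cmod z) / 2"
  have d: "d > 0" "cmod z + d < 1"
    using z by (auto simp: d_def field_simps)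
  have sub: "cmod w \<le> cmod z + d" if "w \<in> cball z d" for w
    using that norm_triangle_sub[of w z] by (auto simp: dist_norm norm_minus_commute)
  obtain M where M': "summable M" "\<And>k w. cmod w \<le> cmod z + d \<Longrightarrow> cmod (g k w) \<le> M k"
    using M[of "cmod z + d"] d by (smt (verit) norm_ge_zero)
  have "uniform_limit (cball z d) (\<lambda>n w. \<Sum>k<n. g k w) (\<lambda>w. \<Sum>k. g k w) sequentially"
    using sub M' by (intro Weierstrass_m_test) auto
  moreover have "cball z d \<subseteq> unit_disc"
    using sub d by fastforce
  ultimately show "\<exists>d>0. cball z d \<subseteq> unit_disc \<and>
      uniform_limit (cball z d) (\<lambda>n w. \<Sum>k<n. g k w) (\<lambda>w. \<Sum>k. g k w) sequentially"
    using d(1) by blast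
qed simp

text \<open>On the circle \<open>cmod z = 1 - r k\<close> the weighted \<open>k\<close>-th term is
  at least \<open>exp (- 4)\<close>. The size of \<open>R\<close> keeps the earlier terms together,
  and likewise the later ones, below a quarter of this, so half of the main term remains.\<close>

lemma lacunary_growth_function:
  fixes r :: "nat \<Rightarrow> real"
  assumes \<gamma>: "\<gamma> > 0" and r: "\<And>k. 0 < r k" "\<And>k. r k \<le> 1 / 2"
    and R: "R \<ge> 1 + 4 * bump_const \<gamma> * exp 4"
    and lac: "\<And>k. R * r (Suc k) powr \<gamma> \<le> r k powr \<gamma>"
  obtains f where "f \<in> growth_space \<gamma>"
    and "\<And>k z. cmod z = 1 - r k \<Longrightarrow> exp (- 4) / 2 \<le> r k powr \<gamma> * cmod (f z)"
proof -
  define C where "C = bump_const \<gamma>"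
  have C: "C \<ge> 1" by (simp add: C_def bump_const_def)
  \<comment> \<open>\<open>C / (R - 1)\<close> will bound each of the two tails around the dominant
    term.\<close>
  have CR: "C / (R - 1) \<le> exp (- 4) / 4"
  proof -
    have "4 * C * exp 4 \<le> R - 1" using R by (simp add: C_def)
    moreover have "0 < 4 * C * exp 4" using C by simp
    ultimately show ?thesis by (simp add: exp_minus field_simps)
  qed
  have "4 * C * exp 4 \<ge> 4 * 1 * (1::real)"
    using C by (intro mult_mono) auto
  then have R2: "R \<ge> 2" using R by (simp add: C_def)
  define g where "g k z = of_real (r k powr (- \<gamma>)) * z ^ bump_exponent (r k)" for k and z :: complex
  \<comment> \<open>\<open>u s k\<close> is \<open>(s / r k) powr \<gamma>\<close>. For fixed
    \<open>s\<close> it is lacunary and increasing in \<open>k\<close>, with ratio at least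
    \<open>R\<close>.\<close>
  define u where "u s k = s powr \<gamma> * r k powr (- \<gamma>)" for s k
  have upos: "u s k > 0" if "s > 0" for s k
    using that r(1)[of k] by (simp add: u_def)
  have ulac: "R * u s k \<le> u s (Suc k)" if "s > 0" for s k
  proof -
    have "R * r k powr (- \<gamma>) \<le> r (Suc k) powr (- \<gamma>)"
      using lac[of k] r(1)[of k] r(1)[of "Suc k"] by (simp add: powr_minus field_simps)
    then have "s powr \<gamma> * (R * r k powr (- \<gamma>)) \<le> s powr \<gamma> * r (Suc k) powr (- \<gamma>)"
      by (intro mult_left_mono) auto
    then show ?thesis by (simp add: u_def mult_ac)
  qed
  have ulac2: "2 * u s k \<le> u s (Suc k)" if "s > 0" for s k
    using ulac[OF that, of k] mult_right_mono[OF R2, of "u s k"] upos[OF that, of k] by linarith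
  have sum6: "(\<Sum>k<n. C * min (u s k) (1 / u s k)) \<le> 6 * C" if "s > 0" for s n
    using lacunary_sum_min_le[of "u s" n, OF upos ulac2] that C
    by (simp add: sum_distrib_left[symmetric])
  have summ: "summable (\<lambda>k. C * min (u s k) (1 / u s k))" if "s > 0" for s
  proof (rule bounded_imp_summable)
    show "0 \<le> C * min (u s k) (1 / u s k)" for k
      using upos[OF that, of k] C by simp
    show "(\<Sum>k\<le>n. C * min (u s k) (1 / u s k)) \<le> 6 * C" for n
      using sum6[OF that, of "Suc n"] by (simp only: lessThan_Suc_atMost)
  qed
  have gnorm: "s powr \<gamma> * cmod (g k z) = u s k * cmod z ^ bump_exponent (r k)" for s k z
    by (simp add: g_def u_def norm_mult norm_power)
  \<comment> \<open>The inequality \<open>cmod z \<le> 1 - s\<close>, instead of equality, makes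
    this serve both as the weighted bound at one point and as the M-test majorant on a whole
    disc.\<close>
  have gle: "s powr \<gamma> * cmod (g k z) \<le> C * min (u s k) (1 / u s k)"
    if "0 < s" "s \<le> 1" "cmod z \<le> 1 - s" for s k z
  proof -
    have "u s k * cmod z ^ bump_exponent (r k) \<le> u s k * (1 - s) ^ bump_exponent (r k)"
      using that upos[of s k] by (intro mult_left_mono power_mono) auto
    also have "\<dots> \<le> C * min (u s k) (1 / u s k)"
      using bump_upper[OF \<gamma> r(1)[of k] that(1,2)] by (simp add: u_def C_def)
    finally show ?thesis by (simp add: gnorm)
  qed
  have dom: "\<exists>M. summable M \<and> (\<forall>k z. cmod z \<le> \<rho> \<longrightarrow> cmod (g k z) \<le> M k)"
    if \<rho>: "0 < \<rho>" "\<rho> < 1" for \<rho>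
  proof (intro exI conjI allI impI)
    let ?s = "1 - \<rho>"
    show "summable (\<lambda>k. (C * min (u ?s k) (1 / u ?s k)) / ?s powr \<gamma>)"
      using summ[of ?s] \<rho> by (intro summable_divide) auto
    fix k and z :: complex assume "cmod z \<le> \<rho>"
    then show "cmod (g k z) \<le> (C * min (u ?s k) (1 / u ?s k)) / ?s powr \<gamma>"
      using gle[of ?s z k] \<rho> by (simp add: pos_le_divide_eq mult.commute)
  qed
  define f where "f z = (\<Sum>k. g k z)" for z
  have hol: "f holomorphic_on unit_disc"
    unfolding f_def by (rule holomorphic_suminf_disc[OF _ dom]) (auto simp: g_def intro!: holomorphic_intros)
  have sg: "summable (\<lambda>k. g k z)" if z: "cmod z < 1" for z
  proof -
    obtain M where "summable M" "\<forall>k w. cmod w \<le> (cmod z + 1) / 2 \<longrightarrow> cmod (g k w) \<le> M k"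
      using dom[of "(cmod z + 1) / 2"] z by (auto simp: add_nonneg_pos)
    then show ?thesis
      using z by (intro summable_comparison_test[of "\<lambda>k. g k z" M]) auto
  qed
  have lim: "(\<lambda>n. s powr \<gamma> * cmod (\<Sum>k<n. g k z)) \<longlonglongrightarrow> s powr \<gamma> * cmod (f z)"
    if "cmod z < 1" for s z
    unfolding f_def using summable_LIMSEQ[OF sg[OF that]] by (intro tendsto_intros)
  \<comment> \<open>The bound \<open>6 * C\<close> holds for every partial sum and passes to the
    limit.\<close>
  have up: "(1 - cmod z) powr \<gamma> * cmod (f z) \<le> 6 * C" if z: "cmod z < 1" for z
  proof (rule LIMSEQ_le_const2[OF lim[OF z]], intro exI allI impI)
    fix n :: nat
    let ?s = "1 - cmod z"
    have "?s powr \<gamma> * cmod (\<Sum>k<n. g k z) \<le> (\<Sum>k<n. ?s powr \<gamma> * cmod (g k z))"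
      unfolding sum_distrib_left[symmetric] by (intro mult_left_mono norm_sum) auto
    also have "\<dots> \<le> (\<Sum>k<n. C * min (u ?s k) (1 / u ?s k))"
      using z by (intro sum_mono gle) auto
    also have "\<dots> \<le> 6 * C"
      using sum6 z by simp
    finally show "?s powr \<gamma> * cmod (\<Sum>k<n. g k z) \<le> 6 * C" .
  qed
  have low: "exp (- 4) / 2 \<le> r k powr \<gamma> * cmod (f z)" if z: "cmod z = 1 - r k" for k z
  proof -
    let ?s = "r k"
    have z1: "cmod z < 1" using z r(1)[of k] by simp
    \<comment> \<open>At its own depth the \<open>k\<close>-th parameter is 1, so both tail bounds
      become \<open>C / (R - 1)\<close>.\<close>
    have uk: "u ?s k = 1"
      using r(1)[of k] by (simp add: u_def powr_minus)
    have gl: "?s powr \<gamma> * cmod (g j z) \<le> C * min (u ?s j) (1 / u ?s j)" for j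
      using r[of k] z by (intro gle) auto
    have main: "exp (- 4) \<le> ?s powr \<gamma> * cmod (g k z)"
      using bump_lower[OF r[of k]] by (simp add: gnorm uk z)
    have below: "?s powr \<gamma> * cmod (\<Sum>j<k. g j z) \<le> exp (- 4) / 4"
    proof -
      have "?s powr \<gamma> * cmod (\<Sum>j<k. g j z) \<le> (\<Sum>j<k. ?s powr \<gamma> * cmod (g j z))"
        unfolding sum_distrib_left[symmetric] by (intro mult_left_mono norm_sum) auto
      also have "\<dots> \<le> (\<Sum>j<k. C * u ?s j)"
        using gl C by (intro sum_mono) (smt (verit) mult_left_mono min.cobounded1)
      also have "\<dots> \<le> C * (u ?s k / (R - 1))"
        unfolding sum_distrib_left[symmetric] using R2 C upos ulac r(1)
        by (intro mult_left_mono lacunary_sum_below_le) auto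
      finally show ?thesis
        unfolding uk times_divide_eq_right mult_1_left mult_1_right using CR by (rule order_trans)
    qed
    have above: "?s powr \<gamma> * cmod (\<Sum>j=Suc k..<n. g j z) \<le> exp (- 4) / 4" for n
    proof -
      have "?s powr \<gamma> * cmod (\<Sum>j=Suc k..<n. g j z) \<le> (\<Sum>j=Suc k..<n. ?s powr \<gamma> * cmod (g j z))"
        unfolding sum_distrib_left[symmetric] by (intro mult_left_mono norm_sum) auto
      also have "\<dots> \<le> (\<Sum>j=Suc k..<n. C * (1 / u ?s j))"
        using gl C by (intro sum_mono) (smt (verit) mult_left_mono min.cobounded2)
      also have "\<dots> \<le> C * (1 / (u ?s k * (R - 1)))"
        unfolding sum_distrib_left[symmetric] using R2 C upos ulac r(1)
        by (intro mult_left_mono lacunary_sum_above_le) auto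
      finally show ?thesis
        unfolding uk times_divide_eq_right mult_1_left mult_1_right using CR by (rule order_trans)
    qed
    show ?thesis
    proof (rule LIMSEQ_le_const[OF lim[OF z1]], intro exI allI impI)
      fix n assume n: "Suc k \<le> n"
      let ?A = "\<Sum>j<k. g j z" and ?B = "\<Sum>j=Suc k..<n. g j z"
      \<comment> \<open>Each partial sum containing the \<open>k\<close>-th term is split around it.
        The reverse triangle inequality then leaves at least \<open>exp (- 4)\<close> minus two
        quarters of it.\<close>
      have "(\<Sum>j<n. g j z) = (\<Sum>j<Suc k. g j z) + ?B"
        using sum.atLeastLessThan_concat[of 0 "Suc k" n "\<lambda>j. g j z"] n
        by (simp only: atLeast0LessThan)
      then have "g k z = (\<Sum>j<n. g j z) - ?A - ?B"
        by simp
      then have "cmod (g k z) \<le> cmod (\<Sum>j<n. g j z) + cmod ?A + cmod ?B"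
        using norm_triangle_ineq4[of "(\<Sum>j<n. g j z) - ?A" ?B]
          norm_triangle_ineq4[of "\<Sum>j<n. g j z" ?A] by simp
      then have "?s powr \<gamma> * cmod (g k z) \<le>
          ?s powr \<gamma> * (cmod (\<Sum>j<n. g j z) + cmod ?A + cmod ?B)"
        by (intro mult_left_mono) auto
      then show "exp (- 4) / 2 \<le> ?s powr \<gamma> * cmod (\<Sum>j<n. g j z)"
        using main below above[of n] by (simp add: distrib_left)
    qed
  qed
  show thesis
  proof (rule that)
    show "f \<in> growth_space \<gamma>"
      unfolding growth_space_iff using hol up by (auto intro!: exI[of _ "6 * C"])
  qed (rule low)
qed

section \<open>Necessity: testing a multiplier on the series\<close>

text \<open>If \<open>h\<close> fails to be little, a lacunary sequence of bad points exists. A test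
  function of maximal growth along it keeps the weighted product away from 0 there.\<close>

lemma multiplier_imp_little_growth:
  assumes \<gamma>: "\<gamma> > 0" and hol: "h holomorphic_on unit_disc"
    and mult: "\<And>f. f \<in> growth_space \<gamma> \<Longrightarrow> mult_op h f \<in> little_growth_space \<delta>"
  shows "h \<in> little_growth_space (\<delta> - \<gamma>)"
proof (rule ccontr)
  assume "h \<notin> little_growth_space (\<delta> - \<gamma>)"
  then obtain e where e: "e > 0" and ex: "\<And>d. d > 0 \<Longrightarrow>
      \<exists>z. 1 - d < cmod z \<and> cmod z < 1 \<and> e \<le> (1 - cmod z) powr (\<delta> - \<gamma>) * cmod (h z)"
    using hol unfolding little_growth_space_iff by (meson not_less)
  define R where "R = 1 + 4 * bump_const \<gamma> * exp 4"
  have R: "R > 0"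
    by (simp add: R_def bump_const_def add_pos_nonneg)
  \<comment> \<open>The bound \<open>1 / (real n + 2)\<close> forces the depths to 0 and keeps them
    below \<open>1 / 2\<close> already for \<open>n = 0\<close>. \<open>Q\<close> is the lacunarity
    of consecutive depths.\<close>
  define P where "P n z \<longleftrightarrow> cmod z < 1 \<and> 1 - cmod z < 1 / (real n + 2) \<and>
      e \<le> (1 - cmod z) powr (\<delta> - \<gamma>) * cmod (h z)" for n z
  define Q where "Q z w \<longleftrightarrow> R * (1 - cmod w) powr \<gamma> \<le> (1 - cmod z) powr \<gamma>" for z w :: complex
  have "\<exists>\<zeta>. \<forall>n. P n (\<zeta> n) \<and> Q (\<zeta> n) (\<zeta> (Suc n))"
  proof (rule dependent_nat_choice)
    show "\<exists>z. P 0 z"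
      using ex[of "1 / 2"] by (auto simp: P_def)
  next
    fix z n assume "P n z"
    then have z: "1 - cmod z > 0" by (simp add: P_def)
    \<comment> \<open>The second entry solves
      \<open>R * x powr \<gamma> = (1 - cmod z) powr \<gamma>\<close> for the depth \<open>x\<close>
      of the next point.\<close>
    define d where "d = min (1 / (real (Suc n) + 2)) ((1 - cmod z) * R powr (- (1 / \<gamma>)))"
    have "d > 0" using z R by (simp add: d_def)
    from ex[OF this] obtain w where w: "1 - d < cmod w" "cmod w < 1"
      "e \<le> (1 - cmod w) powr (\<delta> - \<gamma>) * cmod (h w)" by blast
    have "1 - cmod w < 1 / (real (Suc n) + 2)" and wz: "1 - cmod w \<le> (1 - cmod z) * R powr (- (1 / \<gamma>))"
      using w(1) by (auto simp: d_def min_def split: if_splits)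
    then have "P (Suc n) w" using w by (simp add: P_def)
    moreover have "Q z w"
    proof -
      have "(1 - cmod w) powr \<gamma> \<le> ((1 - cmod z) * R powr (- (1 / \<gamma>))) powr \<gamma>"
        using wz w(2) \<gamma> by (intro powr_mono2) auto
      also have "\<dots> = (1 - cmod z) powr \<gamma> / R"
        using z R \<gamma> by (simp add: powr_mult powr_divide powr_powr powr_minus_divide)
      finally show ?thesis using R by (simp add: Q_def field_simps)
    qed
    ultimately show "\<exists>w. P (Suc n) w \<and> Q z w" by blast
  qed
  then obtain \<zeta> where \<zeta>: "\<And>n. P n (\<zeta> n)" "\<And>n. Q (\<zeta> n) (\<zeta> (Suc n))" by blast
  define r where "r n = 1 - cmod (\<zeta> n)" for n
  have r: "r n > 0" "r n < 1 / (real n + 2)" "e \<le> r n powr (\<delta> - \<gamma>) * cmod (h (\<zeta> n))" for n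
    using \<zeta>(1)[of n] by (auto simp: P_def r_def)
  have r2: "r n \<le> 1 / 2" for n
  proof -
    have "1 / (real n + 2) \<le> 1 / 2" by (intro divide_left_mono) auto
    then show ?thesis using r(2)[of n] by linarith
  qed
  obtain f where f: "f \<in> growth_space \<gamma>"
    "\<And>k z. cmod z = 1 - r k \<Longrightarrow> exp (- 4) / 2 \<le> r k powr \<gamma> * cmod (f z)"
  proof (rule lacunary_growth_function[of \<gamma> r R])
    show "R * r (Suc k) powr \<gamma> \<le> r k powr \<gamma>" for k
      using \<zeta>(2)[of k] by (simp add: Q_def r_def)
  qed (use \<gamma> r r2 in \<open>auto simp: R_def\<close>)
  \<comment> \<open>The threshold is the product of the lower bounds for \<open>h\<close> and
    \<open>f\<close> at the points \<open>\<zeta> n\<close>. Any \<open>\<zeta> n\<close> deep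
    enough in the annulus then gives a contradiction.\<close>
  have "e * (exp (- 4) / 2) > 0" using e by simp
  then obtain d where d: "d > 0" "\<And>z. 1 - d < cmod z \<Longrightarrow> cmod z < 1 \<Longrightarrow>
      (1 - cmod z) powr \<delta> * cmod (mult_op h f z) < e * (exp (- 4) / 2)"
    using mult[OF f(1)] unfolding little_growth_space_iff by meson
  obtain n :: nat where n: "1 / d < real n"
    using reals_Archimedean2 by blast
  have "1 / (real n + 2) < d"
    using n d(1) by (simp add: field_simps)
  then have rd: "r n < d" using r(2)[of n] by linarith
  have "e * (exp (- 4) / 2) \<le>
      (r n powr (\<delta> - \<gamma>) * cmod (h (\<zeta> n))) * (r n powr \<gamma> * cmod (f (\<zeta> n)))"
    using r(3)[of n] f(2)[of "\<zeta> n" n] e by (intro mult_mono) (auto simp: r_def)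
  also have "\<dots> = (r n powr (\<delta> - \<gamma>) * r n powr \<gamma>) * cmod (mult_op h f (\<zeta> n))"
    by (simp add: mult_op_def norm_mult)
  also have "\<dots> = (1 - cmod (\<zeta> n)) powr \<delta> * cmod (mult_op h f (\<zeta> n))"
    by (simp add: powr_add[symmetric] r_def)
  also have "\<dots> < e * (exp (- 4) / 2)"
    using r(1)[of n] rd by (intro d(2)) (auto simp: r_def)
  finally show False by simp
qed

theorem proposition4p6:
  fixes \<gamma> \<delta> :: real
  assumes "0 < \<gamma>" and "\<gamma> < \<delta>"
  shows "(\<forall>h\<in>analytic_disc.
            (\<forall>f\<in>growth_space \<gamma>. mult_op h f \<in> little_growth_space \<delta>) \<longleftrightarrow>
            h \<in> little_growth_space (\<delta> - \<gamma>)) \<and>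
         multipliers (growth_space \<gamma>) (little_growth_space \<delta>) = little_growth_space (\<delta> - \<gamma>)"
proof -
  have iff: "(\<forall>f\<in>growth_space \<gamma>. mult_op h f \<in> little_growth_space \<delta>) \<longleftrightarrow>
      h \<in> little_growth_space (\<delta> - \<gamma>)" if "h \<in> analytic_disc" for h
    using that multiplier_imp_little_growth[OF assms(1), of h \<delta>]
      mult_op_little_growth[of h "\<delta> - \<gamma>" _ \<gamma>]
    by (auto simp: analytic_disc_def)
  \<comment> \<open>The equivalence is only available for analytic \<open>h\<close>; this inclusion
    supplies analyticity for the direction from the little space to the multipliers.\<close>
  moreover have "little_growth_space (\<delta> - \<gamma>) \<subseteq> analytic_disc"
    by (auto simp: little_growth_space_def)
  ultimately have "multipliers (growth_space \<gamma>) (little_growth_space \<delta>) = little_growth_space (\<delta> - \<gamma>)"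
    unfolding multipliers_def image_subset_iff by blast
  with iff show ?thesis by blast
qed

end
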